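(* Let $n\ge 4$. Then $\Theta_1(\Lambda_n)\cup\Theta_n(\Lambda_n)$ is a maximal (with respect to inclusion) edge general position set of $\Lambda_n$. Moreover, ${\rm gp_e}(\Lambda_n)\ge 2F_{n-1}$.
   Context: Fibonacci numbers: $F_0=0$, $F_1=1$, $F_{m+2}=F_{m+1}+F_m$. The Lucas cube $\Lambda_n$ is the graph whose vertices are the binary strings of length $n$ with no two consecutive 1s and not both starting and ending with 1, two vertices being adjacent iff they differ in exactly one coordinate. For $i\in\{1,\ldots,n\}$, $\Theta_i(\Lambda_n)$ is the set of edges of $\Lambda_n$ whose endpoints differ in coordinate $i$. A set of edges $X\subseteq E(G)$ is an edge general position set of a graph $G$ if no three edges of $X$ lie on a common shortest path of $G$; ${\rm gp_e}(G)$ is the maximum cardinality of an edge general position set of $G$. *)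

theory Defs
  imports "HOL-Number_Theory.Fib"
begin

text \<open>
  A simple graph is a pair of a vertex set and a set of edges, each edge being the
  two-element set of its endpoints.
\<close>

type_synonym 'a graph = "'a set \<times> 'a set set"

abbreviation verts :: "'a graph \<Rightarrow> 'a set" where "verts G \<equiv> fst G"
abbreviation edges :: "'a graph \<Rightarrow> 'a set set" where "edges G \<equiv> snd G"

definition path_edges :: "'a list \<Rightarrow> 'a set set" where
  "path_edges P = {{P ! i, P ! Suc i} | i. Suc i < length P}"

definition is_path :: "'a graph \<Rightarrow> 'a list \<Rightarrow> bool" where
  "is_path G P \<longleftrightarrow> P \<noteq> [] \<and> distinct P \<and> set P \<subseteq> verts G \<and> path_edges P \<subseteq> edges G"

definition shortest_path :: "'a graph \<Rightarrow> 'a list \<Rightarrow> bool" where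
  "shortest_path G P \<longleftrightarrow> is_path G P \<and>
     (\<forall>Q. is_path G Q \<and> hd Q = hd P \<and> last Q = last P \<longrightarrow> length P \<le> length Q)"

definition edge_general_position :: "'a graph \<Rightarrow> 'a set set \<Rightarrow> bool" where
  "edge_general_position G X \<longleftrightarrow> X \<subseteq> edges G \<and>
     \<not> (\<exists>P e\<^sub>1 e\<^sub>2 e\<^sub>3. shortest_path G P \<and> {e\<^sub>1, e\<^sub>2, e\<^sub>3} \<subseteq> X \<inter> path_edges P \<and>
          e\<^sub>1 \<noteq> e\<^sub>2 \<and> e\<^sub>1 \<noteq> e\<^sub>3 \<and> e\<^sub>2 \<noteq> e\<^sub>3)"

definition maximal_edge_general_position :: "'a graph \<Rightarrow> 'a set set \<Rightarrow> bool" where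
  "maximal_edge_general_position G X \<longleftrightarrow> edge_general_position G X \<and>
     (\<forall>Y. edge_general_position G Y \<and> X \<subseteq> Y \<longrightarrow> Y = X)"

text \<open>Only meaningful for graphs with finitely many edges.\<close>

definition gp_e :: "'a graph \<Rightarrow> nat" where
  "gp_e G = Max {card X | X. edge_general_position G X}"

text \<open>
  Binary strings are Boolean lists, \<open>True\<close> standing for 1; coordinate \<open>i\<close> of the
  string \<open>w\<close>, counted from 1, is \<open>w ! (i - 1)\<close>.
\<close>

definition lucas_strings :: "nat \<Rightarrow> bool list set" where
  "lucas_strings n = {w. length w = n \<and>
     (\<forall>i. Suc i < n \<longrightarrow> \<not> (w ! i \<and> w ! Suc i)) \<and>
     (w \<noteq> [] \<longrightarrow> \<not> (hd w \<and> last w))}"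

definition lucas_cube :: "nat \<Rightarrow> bool list graph" where
  "lucas_cube n = (lucas_strings n,
     {{u, v} | u v. u \<in> lucas_strings n \<and> v \<in> lucas_strings n \<and>
        card {i \<in> {1..n}. u ! (i - 1) \<noteq> v ! (i - 1)} = 1})"

definition lucas_Theta :: "nat \<Rightarrow> nat \<Rightarrow> bool list set set" where
  "lucas_Theta n i = {{u, v} | u v. {u, v} \<in> edges (lucas_cube n) \<and> u ! (i - 1) \<noteq> v ! (i - 1)}"

end

theory Submission
  imports Defs
begin

text \<open>
  The Lucas cube is isometric in the hypercube, so a shortest path flips every coordinate at most
  once and meets each class \<open>\<Theta>\<^sub>i\<close> in at most one edge; hence the union of two classes is in edge
  general position. An edge in any other direction \<open>i\<close> lies on a geodesic that also flips the
  coordinates 1 and \<open>n\<close>, whence maximality. The edges of \<open>\<Theta>\<^sub>1\<close> and of \<open>\<Theta>\<^sub>n\<close> are obtained from the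
  Fibonacci strings of length \<open>n - 3\<close>, padded so that coordinate 1 or \<open>n\<close> can be flipped freely.
\<close>

section \<open>Lucas strings and changes of single bits\<close>

text \<open>Positions count from 0 here; \<open>card_shifted_coords\<close> and
  \<open>edge_in_Theta_iff\<close> translate to the coordinates of \<open>lucas_cube\<close> and
  \<open>lucas_Theta\<close>, which count from 1.\<close>

definition diff_coords :: "bool list \<Rightarrow> bool list \<Rightarrow> nat set" where
  "diff_coords u v = {i. i < length u \<and> u ! i \<noteq> v ! i}"

lemma finite_diff_coords [simp]: "finite (diff_coords u v)"
  by (simp add: diff_coords_def)

lemma diff_coords_flip: "i < length u \<Longrightarrow> diff_coords u (u[i := \<not> u ! i]) = {i}"
  by (auto simp: diff_coords_def nth_list_update split: if_splits)

lemma lucas_strings_iff: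
  assumes "n > 0"
  shows "w \<in> lucas_strings n \<longleftrightarrow> length w = n \<and>
           (\<forall>i. Suc i < n \<longrightarrow> \<not> (w ! i \<and> w ! Suc i)) \<and> \<not> (w ! 0 \<and> w ! (n - 1))"
  using assms by (auto simp: lucas_strings_def hd_conv_nth last_conv_nth)

lemma lucas_strings_length: "w \<in> lucas_strings n \<Longrightarrow> length w = n"
  by (simp add: lucas_strings_def)

text \<open>Every defining condition forbids a pair of 1s, so turning 1s into 0s cannot violate
  it.\<close>

lemma lucas_strings_mono:
  assumes "v \<in> lucas_strings n" "length u = n" "\<And>i. i < n \<Longrightarrow> u ! i \<Longrightarrow> v ! i"
  shows "u \<in> lucas_strings n"
proof (cases "n = 0")
  case True
  then show ?thesis using assms by (simp add: lucas_strings_def)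
next
  case False
  then have "n > 0" by simp
  then show ?thesis
    using assms unfolding lucas_strings_iff[OF \<open>n > 0\<close>]
    by (metis Suc_lessD diff_less zero_less_one)
qed

lemma lucas_strings_update_False: "w \<in> lucas_strings n \<Longrightarrow> w[i := False] \<in> lucas_strings n"
  by (cases "i < n", rule lucas_strings_mono, assumption)
     (auto simp: lucas_strings_length nth_list_update list_update_beyond split: if_splits)

text \<open>Positions form a cycle: only the pairs of \<open>i\<close> with its two cyclic
  neighbours can become forbidden. For \<open>n = 1\<close> position 0 would be its own neighbour
  and the criterion would fail.\<close>

lemma lucas_strings_update_True_iff:
  assumes "w \<in> lucas_strings n" "i < n" "n \<ge> 2"
  shows "w[i := True] \<in> lucas_strings n \<longleftrightarrow>
    (if i = 0 then \<not> w ! (n - 1) else \<not> w ! (i - 1)) \<and>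
    (if i = n - 1 then \<not> w ! 0 else \<not> w ! Suc i)"
proof -
  obtain m where m: "n = Suc (Suc m)" using assms(3) that[of "n - 2"] by simp
  then have "n > 0" by simp
  note L = lucas_strings_iff[OF this]
  have len: "length w = n" using assms(1) by (rule lucas_strings_length)
  show ?thesis (is "?l \<longleftrightarrow> ?r")
  proof
    assume ?l
    then have "\<not> (w[i := True] ! j \<and> w[i := True] ! Suc j)" if "Suc j < n" for j
      using that by (simp add: L)
    from this[of "i - 1"] this[of i] \<open>?l\<close> show ?r
      using assms(2,3) len by (auto simp: L nth_list_update split: if_splits)
  next
    assume ?r
    then show ?l
      using assms len by (cases i) (auto simp: L[unfolded m] m nth_list_update split: if_splits)
  qed
qed

lemma finite_lucas_strings: "finite (lucas_strings n)"
  by (rule finite_subset[OF _ finite_lists_length_eq[of "UNIV :: bool set" n]])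
     (auto simp: lucas_strings_def)

section \<open>Edges of the Lucas cube as single flips\<close>

lemma verts_lucas_cube [simp]: "verts (lucas_cube n) = lucas_strings n"
  by (simp add: lucas_cube_def)

lemma finite_edges_lucas_cube: "finite (edges (lucas_cube n))"
  by (rule finite_subset[of _ "Pow (lucas_strings n)"])
     (auto simp: lucas_cube_def finite_lucas_strings)

lemma card_shifted_coords:
  assumes "length u = n"
  shows "card {i \<in> {1..n}. u ! (i - 1) \<noteq> v ! (i - 1)} = card (diff_coords u v)"
proof -
  have "{i \<in> {1..n}. u ! (i - 1) \<noteq> v ! (i - 1)} = Suc ` diff_coords u v"
  proof (intro set_eqI iffI)
    fix i assume "i \<in> {i \<in> {1..n}. u ! (i - 1) \<noteq> v ! (i - 1)}"
    then show "i \<in> Suc ` diff_coords u v"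
      using assms by (intro image_eqI[of _ _ "i - 1"]) (auto simp: diff_coords_def)
  qed (use assms in \<open>auto simp: diff_coords_def\<close>)
  then show ?thesis by (simp add: card_image)
qed

lemma card_diff_coords_eq_1:
  assumes "length u = length v"
  shows "card (diff_coords u v) = 1 \<longleftrightarrow> (\<exists>i < length u. v = u[i := \<not> u ! i])"
proof
  assume "card (diff_coords u v) = 1"
  then obtain i where i: "diff_coords u v = {i}" by (auto simp: card_1_singleton_iff)
  then have "i < length u" "u ! i \<noteq> v ! i" by (auto simp: diff_coords_def)
  moreover have "u ! j = v ! j" if "j < length u" "j \<noteq> i" for j
    using i that by (auto simp: diff_coords_def)
  ultimately have "v = u[i := \<not> u ! i]"
    using assms by (intro nth_equalityI) (auto simp: nth_list_update)
  then show "\<exists>i < length u. v = u[i := \<not> u ! i]" using \<open>i < length u\<close> by blast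
qed (auto simp: diff_coords_flip)

lemma edges_lucas_cube_iff:
  "{u, v} \<in> edges (lucas_cube n) \<longleftrightarrow>
     u \<in> lucas_strings n \<and> v \<in> lucas_strings n \<and> (\<exists>i<n. v = u[i := \<not> u ! i])"
proof -
  have adj: "card {i \<in> {1..n}. a ! (i - 1) \<noteq> b ! (i - 1)} = 1 \<longleftrightarrow> (\<exists>i<n. b = a[i := \<not> a ! i])"
    if "a \<in> lucas_strings n" "b \<in> lucas_strings n" for a b
    using that card_shifted_coords[of a n b] card_diff_coords_eq_1[of a b]
    by (simp add: lucas_strings_length)
  define R where "R a b \<longleftrightarrow> a \<in> lucas_strings n \<and> b \<in> lucas_strings n \<and> (\<exists>i<n. b = a[i := \<not> a ! i])"
    for a b
  \<comment> \<open>An edge is an unordered pair and fixes no orientation; flipping the same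
    position again undoes a flip, so either orientation will do.\<close>
  have sym: "R b a" if R: "R a b" for a b
  proof -
    obtain i where "i < n" "b = a[i := \<not> a ! i]" using R by (auto simp: R_def)
    moreover have "length a = n" using R by (auto simp: R_def lucas_strings_length)
    ultimately have "a = b[i := \<not> b ! i]" by simp
    with \<open>i < n\<close> R show ?thesis unfolding R_def by blast
  qed
  have "a \<in> lucas_strings n \<and> b \<in> lucas_strings n \<and>
      card {i \<in> {1..n}. a ! (i - 1) \<noteq> b ! (i - 1)} = 1 \<longleftrightarrow> R a b" for a b
    unfolding R_def by (intro conj_cong refl adj)
  then have "edges (lucas_cube n) = {{a, b} | a b. R a b}"
    by (simp only: lucas_cube_def snd_conv)
  then have "{u, v} \<in> edges (lucas_cube n) \<longleftrightarrow> (\<exists>a b. {u, v} = {a, b} \<and> R a b)"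
    by simp
  also have "\<dots> \<longleftrightarrow> R u v"
    using sym by (metis doubleton_eq_iff)
  finally show ?thesis by (simp add: R_def)
qed

text \<open>Normal form of an edge: the endpoint with 0 at the flipped position comes first.\<close>

lemma edges_lucas_cubeE:
  assumes "e \<in> edges (lucas_cube n)"
  obtains u i where "e = {u, u[i := True]}" "i < n" "\<not> u ! i"
    "u \<in> lucas_strings n" "u[i := True] \<in> lucas_strings n"
proof -
  obtain u v where e: "e = {u, v}" using assms by (auto simp: lucas_cube_def)
  then obtain i where i: "i < n" "v = u[i := \<not> u ! i]" "u \<in> lucas_strings n" "v \<in> lucas_strings n"
    using assms edges_lucas_cube_iff by blast
  show thesis
  proof (cases "u ! i")
    case True
    then have "u[i := True] = u" by (metis list_update_id)
    with True i have "v[i := True] = u" "\<not> v ! i" by (simp_all add: lucas_strings_length)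
    with that[of v i] e i show thesis by (simp add: insert_commute)
  next
    case False
    with that[of u i] e i show thesis by simp
  qed
qed

section \<open>The classes of parallel edges\<close>

lemma edge_in_Theta_iff:
  "{u, v} \<in> lucas_Theta n (Suc k) \<longleftrightarrow> {u, v} \<in> edges (lucas_cube n) \<and> u ! k \<noteq> v ! k"
  unfolding lucas_Theta_def diff_Suc_1 mem_Collect_eq
  by (metis doubleton_eq_iff)

text \<open>The endpoints differ at the flipped position and nowhere else, so the direction of an
  edge is unique.\<close>

lemma flip_edge_in_Theta_iff:
  assumes "{u, u[i := b]} \<in> edges (lucas_cube n)" "i < n" "u ! i \<noteq> b" "k < n"
  shows "{u, u[i := b]} \<in> lucas_Theta n (Suc k) \<longleftrightarrow> k = i"
proof -
  have "length u = n" using assms(1) edges_lucas_cube_iff lucas_strings_length by blast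
  then show ?thesis
    using assms by (cases "k = i") (simp_all add: edge_in_Theta_iff)
qed

lemma Theta_subset_edges: "lucas_Theta n i \<subseteq> edges (lucas_cube n)"
  by (auto simp: lucas_Theta_def)

lemma Theta_disjoint:
  assumes "j < n" "k < n" "j \<noteq> k"
  shows "lucas_Theta n (Suc j) \<inter> lucas_Theta n (Suc k) = {}"
proof -
  have False if e: "e \<in> lucas_Theta n (Suc j)" "e \<in> lucas_Theta n (Suc k)" for e
  proof -
    from e Theta_subset_edges have ee: "e \<in> edges (lucas_cube n)" by blast
    then obtain u i where "e = {u, u[i := True]}" "i < n" "\<not> u ! i" by (rule edges_lucas_cubeE)
    with flip_edge_in_Theta_iff[of u i True n] ee e assms show False by auto
  qed
  then show ?thesis by blast
qed

section \<open>Walks given by flip instructions\<close>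

lemma path_edges_single [simp]: "path_edges [x] = {}"
  by (simp add: path_edges_def)

lemma path_edges_Cons_Cons [simp]:
  "path_edges (x # y # P) = insert {x, y} (path_edges (y # P))"
proof -
  have "{{(x # y # P) ! i, (x # y # P) ! Suc i} | i. Suc i < length (x # y # P)} =
    insert {x, y} {{(y # P) ! i, (y # P) ! Suc i} | i. Suc i < length (y # P)}" (is "?A = insert _ ?B")
  proof (intro set_eqI iffI)
    fix e assume "e \<in> ?A"
    then obtain i where i: "e = {(x # y # P) ! i, (x # y # P) ! Suc i}" "Suc i < length (x # y # P)"
      by blast
    then show "e \<in> insert {x, y} ?B" by (cases i) auto
  next
    fix e assume "e \<in> insert {x, y} ?B"
    then consider "e = {x, y}" | i where "e = {(y # P) ! i, (y # P) ! Suc i}" "Suc i < length (y # P)"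
      by blast
    then show "e \<in> ?A"
    proof cases
      case 1
      then show ?thesis by (intro CollectI exI[of _ 0]) simp
    next
      case 2
      then show ?thesis by (intro CollectI exI[of _ "Suc i"]) simp
    qed
  qed
  then show ?thesis by (simp add: path_edges_def)
qed

text \<open>A walk is encoded by its start and a list of instructions (position, new bit), so that
  the directions it uses can be read off the list.\<close>

fun walk :: "bool list \<Rightarrow> (nat \<times> bool) list \<Rightarrow> bool list list" where
  "walk s [] = [s]"
| "walk s ((i, b) # ps) = s # walk (s[i := b]) ps"

text \<open>Since no position occurs twice, comparing each new bit with the bit of the start
  \<open>s\<close> already makes every instruction a genuine flip.\<close>

definition lucas_walk :: "nat \<Rightarrow> bool list \<Rightarrow> (nat \<times> bool) list \<Rightarrow> bool" where
  "lucas_walk n s ps \<longleftrightarrow> distinct (map fst ps) \<and> (\<forall>(i, b) \<in> set ps. i < n \<and> s ! i \<noteq> b) \<and>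
     set (walk s ps) \<subseteq> lucas_strings n"

lemma walk_not_Nil [simp]: "walk s ps \<noteq> []"
  by (cases ps) auto

lemma hd_walk [simp]: "hd (walk s ps) = s"
  by (cases ps) auto

lemma length_walk [simp]: "length (walk s ps) = Suc (length ps)"
  by (induction s ps rule: walk.induct) auto

lemma path_edges_Cons_walk [simp]:
  "path_edges (s # walk t ps) = insert {s, t} (path_edges (walk t ps))"
  by (cases ps) auto

lemma walk_nth_unchanged:
  "w \<in> set (walk s ps) \<Longrightarrow> j \<notin> fst ` set ps \<Longrightarrow> w ! j = s ! j"
  by (induction s ps rule: walk.induct) auto

lemma lucas_walk_start: "lucas_walk n s ps \<Longrightarrow> s \<in> lucas_strings n"
  unfolding lucas_walk_def using hd_in_set[OF walk_not_Nil, of s ps] by auto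

lemma lucas_walk_Nil [simp]: "lucas_walk n s [] \<longleftrightarrow> s \<in> lucas_strings n"
  by (simp add: lucas_walk_def)

lemma lucas_walk_Cons:
  "lucas_walk n s ((i, b) # ps) \<longleftrightarrow> s \<in> lucas_strings n \<and> i < n \<and> s ! i \<noteq> b \<and>
     i \<notin> fst ` set ps \<and> lucas_walk n (s[i := b]) ps"
proof -
  \<comment> \<open>The first flip alters only position \<open>i\<close>, which does not recur, so
    later new bits may be compared with \<open>s\<close> or with \<open>s[i := b]\<close>.\<close>
  have "(\<forall>(j, c) \<in> set ps. j < n \<and> s[i := b] ! j \<noteq> c) \<longleftrightarrow> (\<forall>(j, c) \<in> set ps. j < n \<and> s ! j \<noteq> c)"
    if "i \<notin> fst ` set ps"
  proof (rule ball_cong[OF refl])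
    fix p assume "p \<in> set ps"
    with that have "i \<noteq> fst p" by blast
    then show "(case p of (j, c) \<Rightarrow> j < n \<and> s[i := b] ! j \<noteq> c) \<longleftrightarrow>
        (case p of (j, c) \<Rightarrow> j < n \<and> s ! j \<noteq> c)"
      by (cases p) simp
  qed
  then show ?thesis
    by (cases "i \<in> fst ` set ps") (simp_all add: lucas_walk_def conj_ac)
qed

lemma lucas_walk_edge:
  assumes "lucas_walk n s ((i, b) # ps)"
  shows "{s, s[i := b]} \<in> edges (lucas_cube n)"
proof -
  have "s[i := b] = s[i := \<not> s ! i]" using assms by (auto simp: lucas_walk_Cons)
  then show ?thesis
    using assms by (auto simp: edges_lucas_cube_iff lucas_walk_Cons dest: lucas_walk_start)
qed

lemma lucas_walk_is_path: "lucas_walk n s ps \<Longrightarrow> is_path (lucas_cube n) (walk s ps)"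
proof (induction s ps rule: walk.induct)
  case (2 s i b ps)
  then have w: "is_path (lucas_cube n) (walk (s[i := b]) ps)" by (simp add: lucas_walk_Cons)
  \<comment> \<open>Position \<open>i\<close> keeps its new bit for the rest of the walk, so
    \<open>s\<close> cannot return.\<close>
  have "s \<notin> set (walk (s[i := b]) ps)"
  proof
    assume "s \<in> set (walk (s[i := b]) ps)"
    then have "s ! i = s[i := b] ! i"
      using 2(2) by (intro walk_nth_unchanged) (auto simp: lucas_walk_Cons)
    then show False using 2(2) by (auto simp: lucas_walk_Cons lucas_strings_length)
  qed
  with w lucas_walk_edge[OF 2(2)] 2(2) show ?case
    by (auto simp: is_path_def lucas_walk_Cons)
qed (simp add: is_path_def)

text \<open>No flip is undone later, so each one is visible at the end; the number of flips is thus
  the Hamming distance of the ends.\<close>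

lemma diff_coords_last_walk:
  "lucas_walk n s ps \<Longrightarrow> diff_coords s (last (walk s ps)) = fst ` set ps"
proof (induction s ps rule: walk.induct)
  case (2 s i b ps)
  let ?t = "last (walk (s[i := b]) ps)"
  have w: "lucas_walk n (s[i := b]) ps" "i < n" "length s = n" "s ! i \<noteq> b" "i \<notin> fst ` set ps"
    using 2(2) by (auto simp: lucas_walk_Cons lucas_strings_length)
  have "?t ! i = s[i := b] ! i" using w by (intro walk_nth_unchanged) auto
  then have "diff_coords s ?t = insert i (diff_coords (s[i := b]) ?t)"
    using w by (auto simp: diff_coords_def nth_list_update)
  then show ?case using 2(1) w by simp
qed (simp add: diff_coords_def)

lemma card_diff_coords_last_walk:
  assumes "lucas_walk n s ps"
  shows "card (diff_coords s (last (walk s ps))) = length ps"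
  using assms distinct_card[of "map fst ps"] diff_coords_last_walk[OF assms]
  by (simp add: lucas_walk_def)

section \<open>Distances and shortest paths\<close>

text \<open>Here \<open>t j\<close> is the position flipped in step \<open>j\<close> of an arbitrary
  path; the ends can differ only at positions flipped on the way.\<close>

lemma path_flip_coords:
  assumes "is_path (lucas_cube n) P"
  obtains t where
    "\<And>j. Suc j < length P \<Longrightarrow> t j < n \<and> P ! Suc j = (P ! j)[t j := \<not> P ! j ! t j]"
    "diff_coords (hd P) (last P) \<subseteq> t ` {..<length P - 1}"
proof -
  have "\<exists>i. i < n \<and> P ! Suc j = (P ! j)[i := \<not> P ! j ! i]" if "Suc j < length P" for j
  proof -
    have "{P ! j, P ! Suc j} \<in> edges (lucas_cube n)"
      using assms that by (auto simp: is_path_def path_edges_def)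
    then show ?thesis by (auto simp: edges_lucas_cube_iff)
  qed
  then obtain t where
    t: "\<And>j. Suc j < length P \<Longrightarrow> t j < n \<and> P ! Suc j = (P ! j)[t j := \<not> P ! j ! t j]"
    by metis
  have "diff_coords (P ! 0) (P ! k) \<subseteq> t ` {..<k}" if "k < length P" for k
    using that
  proof (induction k)
    case (Suc k)
    have "diff_coords (P ! 0) (P ! Suc k) \<subseteq> insert (t k) (diff_coords (P ! 0) (P ! k))"
      using t[of k] Suc.prems by (auto simp: diff_coords_def nth_list_update)
    then show ?case using Suc by (auto simp: lessThan_Suc)
  qed (simp add: diff_coords_def)
  moreover have "P \<noteq> []" using assms by (simp add: is_path_def)
  ultimately have "diff_coords (hd P) (last P) \<subseteq> t ` {..<length P - 1}"
    by (simp add: hd_conv_nth last_conv_nth)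
  with t that show thesis by blast
qed

text \<open>Each differing position costs a flip, and the number of flips is one less than the
  number of vertices, hence the strict inequality.\<close>

lemma path_length_ge:
  assumes "is_path (lucas_cube n) P"
  shows "card (diff_coords (hd P) (last P)) < length P"
proof -
  obtain t where "diff_coords (hd P) (last P) \<subseteq> t ` {..<length P - 1}"
    by (rule path_flip_coords[OF assms]) (rule that)
  then have "card (diff_coords (hd P) (last P)) \<le> card (t ` {..<length P - 1})"
    by (intro card_mono) auto
  also have "\<dots> \<le> length P - 1"
    using card_image_le[of "{..<length P - 1}" t] by simp
  finally have "card (diff_coords (hd P) (last P)) \<le> length P - 1" .
  moreover have "P \<noteq> []" using assms by (simp add: is_path_def)
  ultimately show ?thesis by (cases P) auto
qed

text \<open>A walk without repeated positions attains the Hamming bound of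
  \<open>path_length_ge\<close>.\<close>

lemma lucas_walk_shortest:
  assumes "lucas_walk n s ps"
  shows "shortest_path (lucas_cube n) (walk s ps)"
  unfolding shortest_path_def
proof (intro conjI allI impI)
  show "is_path (lucas_cube n) (walk s ps)" using assms by (rule lucas_walk_is_path)
  fix Q assume "is_path (lucas_cube n) Q \<and> hd Q = hd (walk s ps) \<and> last Q = last (walk s ps)"
  then show "length (walk s ps) \<le> length Q"
    using path_length_ge[of n Q] card_diff_coords_last_walk[OF assms] by simp
qed

text \<open>Removing the surplus 1s before inserting the missing ones never leaves the Lucas cube,
  so it is an isometric subgraph of the hypercube.\<close>

lemma lucas_walk_exists:
  assumes "u \<in> lucas_strings n" "v \<in> lucas_strings n"
  shows "\<exists>ps. lucas_walk n u ps \<and> last (walk u ps) = v"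
  using assms(1)
proof (induction "card (diff_coords u v)" arbitrary: u)
  case 0
  then have "u = v"
    using assms(2) by (intro nth_equalityI) (auto simp: diff_coords_def lucas_strings_length)
  then show ?case using assms(2) by (intro exI[of _ "[]"]) simp
next
  case (Suc k)
  have len: "length u = n" "length v = n" using Suc.prems assms(2) by (auto simp: lucas_strings_length)
  have "diff_coords u v \<noteq> {}" using Suc.hyps(2) by auto
  then obtain i where i: "i < n" "u ! i \<noteq> v ! i" "u[i := v ! i] \<in> lucas_strings n"
  proof (cases "\<exists>i<n. u ! i \<and> \<not> v ! i")
    case True
    then obtain i where i: "i < n" "u ! i" "\<not> v ! i" by blast
    then have "u[i := v ! i] \<in> lucas_strings n"
      using len by (intro lucas_strings_mono[OF Suc.prems]) (auto simp: nth_list_update split: if_splits)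
    with i that show thesis by blast
  next
    \<comment> \<open>Without surplus 1s, \<open>u\<close> lies below \<open>v\<close> bitwise; so
      does \<open>u\<close> after a missing 1 is inserted, and monotonicity applies.\<close>
    case False
    obtain i where i: "i < n" "u ! i \<noteq> v ! i"
      using \<open>diff_coords u v \<noteq> {}\<close> len by (auto simp: diff_coords_def)
    then have "u[i := v ! i] \<in> lucas_strings n"
      using len False
      by (intro lucas_strings_mono[OF assms(2)]) (auto simp: nth_list_update split: if_splits)
    with i that show thesis by blast
  qed
  let ?u = "u[i := v ! i]"
  have d: "diff_coords u v = insert i (diff_coords ?u v)" "i \<notin> diff_coords ?u v"
    using i len by (auto simp: diff_coords_def nth_list_update)
  then have "k = card (diff_coords ?u v)" using Suc.hyps(2) by simp
  then obtain ps where ps: "lucas_walk n ?u ps" "last (walk ?u ps) = v"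
    using Suc.hyps(1) i(3) by blast
  have "i \<notin> fst ` set ps" using diff_coords_last_walk[OF ps(1)] ps(2) d(2) by simp
  then have "lucas_walk n u ((i, v ! i) # ps)"
    using ps i Suc.prems by (simp add: lucas_walk_Cons)
  then show ?case using ps(2) by (intro exI[of _ "(i, v ! i) # ps"]) simp
qed

text \<open>By isometry a shortest path has at most as many steps as its ends have differing
  positions. The flipped positions cover these, so \<open>t\<close> is injective and only one step
  can flip \<open>k\<close>.\<close>

lemma shortest_path_Theta_unique:
  assumes P: "shortest_path (lucas_cube n) P" and k: "k < n"
    and e: "e \<in> path_edges P" "e \<in> lucas_Theta n (Suc k)"
    and f: "f \<in> path_edges P" "f \<in> lucas_Theta n (Suc k)"
  shows "e = f"
proof -
  have path: "is_path (lucas_cube n) P" using P by (simp add: shortest_path_def)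
  obtain t where
    t: "\<And>j. Suc j < length P \<Longrightarrow> t j < n \<and> P ! Suc j = (P ! j)[t j := \<not> P ! j ! t j]"
    and dt: "diff_coords (hd P) (last P) \<subseteq> t ` {..<length P - 1}"
    using path_flip_coords[OF path] by blast
  have "hd P \<in> lucas_strings n" "last P \<in> lucas_strings n"
    using path by (auto simp: is_path_def)
  then obtain ps where ps: "lucas_walk n (hd P) ps" "last (walk (hd P) ps) = last P"
    using lucas_walk_exists by blast
  have "length P \<le> length (walk (hd P) ps)"
    using P lucas_walk_is_path[OF ps(1)] ps(2) unfolding shortest_path_def by (metis hd_walk)
  then have "length P - 1 \<le> card (diff_coords (hd P) (last P))"
    using card_diff_coords_last_walk[OF ps(1)] ps(2) by simp
  also have "\<dots> \<le> card (t ` {..<length P - 1})" using dt by (intro card_mono) auto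
  finally have inj: "inj_on t {..<length P - 1}"
    by (intro eq_card_imp_inj_on) (use card_image_le[of "{..<length P - 1}" t] in auto)
  have index: "\<exists>j < length P - 1. g = {P ! j, P ! Suc j} \<and> t j = k"
    if g: "g \<in> path_edges P" "g \<in> lucas_Theta n (Suc k)" for g
  proof -
    obtain j where j: "Suc j < length P" "g = {P ! j, P ! Suc j}"
      using g(1) by (auto simp: path_edges_def)
    have "g \<in> edges (lucas_cube n)" using g(2) Theta_subset_edges by blast
    then have "t j = k"
      using flip_edge_in_Theta_iff[of "P ! j" "t j" "\<not> P ! j ! t j" n k] t[OF j(1)] j(2) g(2) k
      by auto
    then show ?thesis using j by (intro exI[of _ j]) auto
  qed
  show ?thesis using index[OF e] index[OF f] inj by (auto simp: inj_on_def)
qed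

section \<open>Geodesics through an inner edge and both end classes\<close>

lemma lucas_walk_Theta_edge:
  "lucas_walk n s ps \<Longrightarrow> i \<in> fst ` set ps \<Longrightarrow> \<exists>e \<in> path_edges (walk s ps). e \<in> lucas_Theta n (Suc i)"
proof (induction s ps rule: walk.induct)
  case (2 s j b ps)
  show ?case
  proof (cases "i = j")
    case True
    have "{s, s[j := b]} \<in> lucas_Theta n (Suc j)"
      using flip_edge_in_Theta_iff[OF lucas_walk_edge[OF 2(2)]] 2(2) by (auto simp: lucas_walk_Cons)
    with True show ?thesis by simp
  next
    case False
    with 2 show ?thesis by (auto simp: lucas_walk_Cons)
  qed
qed simp

text \<open>The walk is extended backwards from \<open>x\<close> to a string with a 1 at position 0.
  That string needs a 0 at position 1; if \<open>x\<close> has a 1 there, it is restored right after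
  position 0 is cleared, so \<open>ps\<close> must not flip position 1 again.\<close>

lemma walk_prepend_first:
  assumes w: "lucas_walk n x ps" and n: "n \<ge> 4" and x: "\<not> x ! 0" "\<not> x ! (n - 1)"
    and ps: "0 \<notin> fst ` set ps" "x ! 1 \<Longrightarrow> 1 \<notin> fst ` set ps"
  shows "\<exists>s qs. lucas_walk n s qs \<and> insert 0 (fst ` set ps) \<subseteq> fst ` set qs \<and>
           path_edges (walk x ps) \<subseteq> path_edges (walk s qs)"
proof -
  have xL: "x \<in> lucas_strings n" using w by (rule lucas_walk_start)
  have len: "length x = n" using xL by (rule lucas_strings_length)
  have id: "x[j := x ! j] = x" for j by (rule list_update_id)
  let ?y = "x[1 := False]"
  let ?s = "?y[0 := True]"
  have y: "?y \<in> lucas_strings n" using xL by (rule lucas_strings_update_False)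
  then have s: "?s \<in> lucas_strings n"
    using x n len by (subst lucas_strings_update_True_iff) (auto simp: nth_list_update)
  have s0: "?s[0 := False] = ?y"
    using id[of 0] x(1) by (simp add: list_update_swap)
  show ?thesis
  proof (cases "x ! 1")
    case True
    then have "?y[1 := True] = x" using id[of 1] by simp
    then have "lucas_walk n ?s ((0, False) # (1, True) # ps)"
      "path_edges (walk x ps) \<subseteq> path_edges (walk ?s ((0, False) # (1, True) # ps))"
      unfolding lucas_walk_Cons walk.simps path_edges_Cons_walk s0 using w s y n len ps True by auto
    then show ?thesis by (intro exI[of _ ?s] exI[of _ "(0, False) # (1, True) # ps"]) auto
  next
    case False
    then have "?y = x" using id[of 1] by simp
    then have "lucas_walk n ?s ((0, False) # ps)"
      "path_edges (walk x ps) \<subseteq> path_edges (walk ?s ((0, False) # ps))"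
      unfolding lucas_walk_Cons walk.simps path_edges_Cons_walk s0 using w s y n len ps by auto
    then show ?thesis by (intro exI[of _ ?s] exI[of _ "(0, False) # ps"]) auto
  qed
qed

text \<open>Since coordinates 1 and \<open>n\<close> are never both 1, a geodesic crossing both classes has to clear
  one of them before setting the other; a 1 in the neighbouring coordinate 2 or \<open>n - 1\<close> is moved
  out of the way in between.\<close>

lemma walk_through_edge:
  assumes n: "n \<ge> 4" and u: "u \<in> lucas_strings n" and v: "u[i := True] \<in> lucas_strings n"
    and i: "0 < i" "i < n - 1" "\<not> u ! i"
  shows "\<exists>s ps. lucas_walk n s ps \<and> 0 \<in> fst ` set ps \<and> n - 1 \<in> fst ` set ps \<and>
           {u, u[i := True]} \<in> path_edges (walk s ps)"
proof -
  \<comment> \<open>The last position \<open>n - 1\<close> becomes \<open>Suc (Suc (Suc m))\<close>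
    and its inner neighbour \<open>Suc (Suc m)\<close>.\<close>
  obtain m where m: "n = Suc (Suc (Suc (Suc m)))"
    using n that[of "n - 4"] by simp
  have len: "length u = Suc (Suc (Suc (Suc m)))" using u m by (simp add: lucas_strings_length)
  have nb: "\<not> u ! (i - 1)" "\<not> u ! Suc i"
    using v i u m by (auto simp: lucas_strings_update_True_iff split: if_splits)
  have ends: "\<not> (u ! 0 \<and> u ! Suc (Suc (Suc m)))"
    using u m by (auto simp: lucas_strings_iff)
  have adj: "\<not> (u ! j \<and> u ! Suc j)" if "Suc j < n" for j
    using u n that by (auto simp: lucas_strings_iff)
  have adj': "u ! 0 \<Longrightarrow> \<not> u ! Suc 0" "u ! Suc 0 \<Longrightarrow> \<not> u ! Suc (Suc 0)"
    "u ! Suc (Suc m) \<Longrightarrow> \<not> u ! Suc m" "u ! Suc (Suc (Suc m)) \<Longrightarrow> \<not> u ! Suc (Suc m)"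
    using adj[of 0] adj[of "Suc 0"] adj[of "Suc m"] adj[of "Suc (Suc m)"] m by auto
  have id0: "u[i := False] = u"
    using i(3) by (metis (full_types) list_update_id)
  \<comment> \<open>A 1 at position \<open>n - 2\<close> has to go before position
    \<open>n - 1\<close> can be set.\<close>
  define clr where "clr = (if u ! Suc (Suc m) then [(Suc (Suc m), False)] else [])"
  have ne: "i \<noteq> 0" "i \<noteq> Suc (Suc (Suc m))" "i < n" "i < Suc (Suc (Suc (Suc m)))" using i m by auto
  have uL: "u \<in> lucas_strings (Suc (Suc (Suc (Suc m))))"
    "u[i := True] \<in> lucas_strings (Suc (Suc (Suc (Suc m))))"
    using u v m by auto
  note simps = lucas_walk_Cons lucas_strings_update_True_iff lucas_strings_update_False uL
     len nth_list_update clr_def ne m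
  \<comment> \<open>The letter records which end bit is 1. In a primed case \<open>i\<close> is
    adjacent to the end that is set last; the edge is then traversed downwards, since a 1 left at
    \<open>i\<close> would block that end.\<close>
  consider (A) "\<not> u ! 0" "\<not> u ! Suc (Suc (Suc m))" "i \<noteq> Suc (Suc m)"
    | (A') "\<not> u ! 0" "\<not> u ! Suc (Suc (Suc m))" "i = Suc (Suc m)"
    | (B) "u ! 0" "\<not> u ! Suc (Suc (Suc m))" "i \<noteq> Suc (Suc m)"
    | (B') "u ! 0" "\<not> u ! Suc (Suc (Suc m))" "i = Suc (Suc m)"
    | (C) "\<not> u ! 0" "u ! Suc (Suc (Suc m))" "i \<noteq> Suc 0"
    | (C') "\<not> u ! 0" "u ! Suc (Suc (Suc m))" "i = Suc 0"
    using ends by blast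
  then show ?thesis
  proof cases
    \<comment> \<open>Both end bits are 0: the walk sets position \<open>n - 1\<close> last, and
      \<open>walk_prepend_first\<close> supplies a clearing of position 0 beforehand.\<close>
    case A
    let ?ps = "[(i, True)] @ clr @ [(n - 1, True)]"
    have w: "lucas_walk n u ?ps"
      using A adj' i(3) nb
      by (simp add: simps)
    \<comment> \<open>If \<open>u ! 1\<close> holds then \<open>i\<close> is not 1, and
      \<open>Suc (Suc m)\<close> is never 1.\<close>
    have "0 \<notin> fst ` set ?ps" "u ! 1 \<Longrightarrow> 1 \<notin> fst ` set ?ps"
      using i m by (auto simp: clr_def split: if_splits)
    then obtain s qs where "lucas_walk n s qs" "insert 0 (fst ` set ?ps) \<subseteq> fst ` set qs"
      "path_edges (walk u ?ps) \<subseteq> path_edges (walk s qs)"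
      using walk_prepend_first[OF w n] A(1,2) m by fastforce
    then show ?thesis by (intro exI[of _ s] exI[of _ qs]) auto
  next
    case A'
    let ?ps = "[(i, False), (n - 1, True)]" and ?v = "u[i := True]"
    have w: "lucas_walk n ?v ?ps"
      using A' i(3) nb id0 uL len
      by (simp add: simps)
    obtain s qs where "lucas_walk n s qs" "insert 0 (fst ` set ?ps) \<subseteq> fst ` set qs"
      "path_edges (walk ?v ?ps) \<subseteq> path_edges (walk s qs)"
      using walk_prepend_first[OF w n] A' m by auto
    then show ?thesis using id0 by (intro exI[of _ s] exI[of _ qs]) (auto simp: insert_commute)
  next
    case B
    let ?ps = "[(i, True), (0, False)] @ clr @ [(n - 1, True)]"
    have w: "lucas_walk n u ?ps"
      using B adj' i(3) nb
      by (simp add: simps)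
    then show ?thesis by (intro exI[of _ u] exI[of _ ?ps]) auto
  next
    case B'
    let ?ps = "[(i, False), (0, False), (n - 1, True)]" and ?v = "u[i := True]"
    have w: "lucas_walk n ?v ?ps"
      using B' i(3) nb id0 uL len
      by (simp add: simps)
    then show ?thesis using id0 by (intro exI[of _ ?v] exI[of _ ?ps]) (auto simp: insert_commute)
  next
    case C
    \<comment> \<open>Mirror image of case \<open>B\<close>; the conditional flip of position 1
      takes the place of \<open>clr\<close>.\<close>
    let ?ps = "[(i, True), (n - 1, False)] @ (if u ! 1 then [(1, False)] else []) @ [(0, True)]"
    have w: "lucas_walk n u ?ps"
      using C adj' i(3) nb
      by (simp add: simps)
    then show ?thesis by (intro exI[of _ u] exI[of _ ?ps]) auto
  next
    case C'
    let ?ps = "[(i, False), (n - 1, False), (0, True)]" and ?v = "u[i := True]"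
    have w: "lucas_walk n ?v ?ps"
      using C' i(3) nb id0 uL len
      by (simp add: simps)
    then show ?thesis using id0 by (intro exI[of _ ?v] exI[of _ ?ps]) (auto simp: insert_commute)
  qed
qed

section \<open>General position and maximality\<close>

text \<open>Pigeonhole: of three edges in two classes, two share a class, and a shortest path meets
  each class at most once.\<close>

lemma edge_general_position_Theta_pair:
  assumes "j < n" "k < n"
  shows "edge_general_position (lucas_cube n) (lucas_Theta n (Suc j) \<union> lucas_Theta n (Suc k))"
proof -
  let ?A = "lucas_Theta n (Suc j)" and ?B = "lucas_Theta n (Suc k)"
  have False if P: "shortest_path (lucas_cube n) P"
    and e: "{e1, e2, e3} \<subseteq> (?A \<union> ?B) \<inter> path_edges P" "e1 \<noteq> e2" "e1 \<noteq> e3" "e2 \<noteq> e3"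
    for P e1 e2 e3
  proof -
    have un: "e = f" if "e \<in> path_edges P" "f \<in> path_edges P"
      "e \<in> ?A \<and> f \<in> ?A \<or> e \<in> ?B \<and> f \<in> ?B" for e f
      using shortest_path_Theta_unique[OF P] assms that by blast
    show False using e un[of e1 e2] un[of e1 e3] un[of e2 e3] by blast
  qed
  then show ?thesis
    unfolding edge_general_position_def using Theta_subset_edges by blast
qed

lemma maximal_edge_general_position_Theta:
  assumes n: "n \<ge> 4"
  shows "maximal_edge_general_position (lucas_cube n) (lucas_Theta n 1 \<union> lucas_Theta n n)"
  unfolding maximal_edge_general_position_def
proof (intro conjI allI impI)
  show "edge_general_position (lucas_cube n) (lucas_Theta n 1 \<union> lucas_Theta n n)"
    using edge_general_position_Theta_pair[of 0 n "n - 1"] n by simp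
next
  fix Y
  assume Y: "edge_general_position (lucas_cube n) Y \<and> lucas_Theta n 1 \<union> lucas_Theta n n \<subseteq> Y"
  have "e \<in> lucas_Theta n 1 \<union> lucas_Theta n n" if "e \<in> Y" for e
  proof (rule ccontr)
    assume e: "e \<notin> lucas_Theta n 1 \<union> lucas_Theta n n"
    have ee: "e \<in> edges (lucas_cube n)" using Y that by (auto simp: edge_general_position_def)
    then obtain u i where u: "e = {u, u[i := True]}" "i < n" "\<not> u ! i"
      "u \<in> lucas_strings n" "u[i := True] \<in> lucas_strings n"
      by (rule edges_lucas_cubeE)
    \<comment> \<open>Lying in neither class, \<open>e\<close> must flip an inner position.\<close>
    have "i \<noteq> 0" "i \<noteq> n - 1"
      using e u ee n flip_edge_in_Theta_iff[of u i True n 0]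
        flip_edge_in_Theta_iff[of u i True n "n - 1"] by auto
    then have "0 < i" "i < n - 1" using u(2) by auto
    then obtain s ps where w: "lucas_walk n s ps" "0 \<in> fst ` set ps" "n - 1 \<in> fst ` set ps"
      "e \<in> path_edges (walk s ps)"
      using walk_through_edge[OF n u(4,5) _ _ u(3)] u(1) by blast
    obtain a where a: "a \<in> path_edges (walk s ps)" "a \<in> lucas_Theta n 1"
      using lucas_walk_Theta_edge[OF w(1,2)] by auto
    obtain b where b: "b \<in> path_edges (walk s ps)" "b \<in> lucas_Theta n n"
      using lucas_walk_Theta_edge[OF w(1,3)] n by auto
    have "a \<noteq> b" using a b Theta_disjoint[of 0 n "n - 1"] n by auto
    moreover have "a \<noteq> e" "b \<noteq> e" using e a b by auto
    \<comment> \<open>One geodesic now carries three distinct edges of \<open>Y\<close>: one from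
      each class, and \<open>e\<close>.\<close>
    moreover have "{a, b, e} \<subseteq> Y \<inter> path_edges (walk s ps)" using Y that a b w(4) by blast
    ultimately show False
      using Y lucas_walk_shortest[OF w(1)] unfolding edge_general_position_def by metis
  qed
  then show "Y = lucas_Theta n 1 \<union> lucas_Theta n n" using Y by blast
qed

section \<open>Fibonacci strings and the size of the two classes\<close>

text \<open>The binary strings without adjacent 1s, generated by their leading bit so that their
  number obeys the Fibonacci recurrence.\<close>

fun fib_strings :: "nat \<Rightarrow> bool list set" where
  "fib_strings 0 = {[]}"
| "fib_strings (Suc 0) = {[False], [True]}"
| "fib_strings (Suc (Suc m)) =
     Cons False ` fib_strings (Suc m) \<union> (\<lambda>w. True # False # w) ` fib_strings m"

lemma finite_fib_strings [simp]: "finite (fib_strings m)"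
  by (induction m rule: fib_strings.induct) auto

text \<open>The offset 2 comes from the base cases: one string of length 0 is \<open>fib 2\<close>,
  two of length 1 are \<open>fib 3\<close>.\<close>

lemma card_fib_strings: "card (fib_strings m) = fib (m + 2)"
proof (induction m rule: fib_strings.induct)
  case (3 m)
  have "card (fib_strings (Suc (Suc m))) =
    card (Cons False ` fib_strings (Suc m)) + card ((\<lambda>w. True # False # w) ` fib_strings m)"
    unfolding fib_strings.simps by (rule card_Un_disjoint) auto
  also have "\<dots> = card (fib_strings (Suc m)) + card (fib_strings m)"
    by (simp add: card_image inj_on_def)
  finally show ?case using 3 by simp
qed auto

lemma fib_strings_no_consecutive:
  "w \<in> fib_strings m \<Longrightarrow> length w = m \<and> successively (\<lambda>a b. \<not> (a \<and> b)) w"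
  by (induction m arbitrary: w rule: fib_strings.induct) (auto simp: successively_Cons)

text \<open>In this form the rules of \<open>successively\<close> for Cons and append evaluate the
  padded strings below.\<close>

lemma lucas_strings_successively:
  "w \<in> lucas_strings n \<longleftrightarrow> length w = n \<and> successively (\<lambda>a b. \<not> (a \<and> b)) w \<and>
     (w \<noteq> [] \<longrightarrow> \<not> (hd w \<and> last w))"
  by (auto simp: lucas_strings_def successively_conv_nth)

lemma Theta_update_True:
  assumes "u \<in> lucas_strings n" "u[k := True] \<in> lucas_strings n" "k < n" "\<not> u ! k"
  shows "{u, u[k := True]} \<in> lucas_Theta n (Suc k)"
proof -
  have "u[k := True] = u[k := \<not> u ! k]" using assms(4) by simp
  then have "{u, u[k := True]} \<in> edges (lucas_cube n)"
    using assms edges_lucas_cube_iff by blast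
  then show ?thesis using assms by (simp add: edge_in_Theta_iff lucas_strings_length)
qed

text \<open>The strings \<open>f w\<close> serve as lower endpoints of edges in direction
  \<open>k\<close>; an edge determines its lower endpoint, so distinct strings give distinct
  edges.\<close>

lemma card_Theta_ge:
  assumes f: "inj_on f (fib_strings m)" "\<And>w. w \<in> fib_strings m \<Longrightarrow> f w \<in> lucas_strings n"
    "\<And>w. w \<in> fib_strings m \<Longrightarrow> (f w)[k := True] \<in> lucas_strings n"
    "\<And>w. w \<in> fib_strings m \<Longrightarrow> \<not> f w ! k" and k: "k < n"
  shows "fib (m + 2) \<le> card (lucas_Theta n (Suc k))"
proof -
  let ?g = "\<lambda>w. {f w, (f w)[k := True]}"
  have "inj_on ?g (fib_strings m)"
  proof (rule inj_onI)
    fix v w assume vw: "v \<in> fib_strings m" "w \<in> fib_strings m" "?g v = ?g w"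
    \<comment> \<open>Bit \<open>k\<close> excludes a crosswise match of a lower with an upper
      endpoint.\<close>
    have "(f w)[k := True] ! k" using f(2)[OF vw(2)] k by (simp add: lucas_strings_length)
    then have "f v \<noteq> (f w)[k := True]" using f(4)[OF vw(1)] by metis
    then have "f v = f w" using vw(3) by (auto simp: doubleton_eq_iff)
    then show "v = w" using f(1) vw by (simp add: inj_on_def)
  qed
  then have "fib (m + 2) = card (?g ` fib_strings m)" by (simp add: card_image card_fib_strings)
  also have "\<dots> \<le> card (lucas_Theta n (Suc k))"
  proof (rule card_mono)
    show "finite (lucas_Theta n (Suc k))"
      using Theta_subset_edges finite_edges_lucas_cube by (rule finite_subset)
    show "?g ` fib_strings m \<subseteq> lucas_Theta n (Suc k)"
      using f k by (auto intro!: Theta_update_True)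
  qed
  finally show ?thesis .
qed

text \<open>Coordinate 1 can be set once its cyclic neighbours, coordinates 2 and \<open>n\<close>,
  are 0; padding these three places leaves \<open>m = n - 3\<close> free ones.\<close>

lemma card_Theta_first: "fib (m + 2) \<le> card (lucas_Theta (m + 3) 1)"
proof -
  have "fib (m + 2) \<le> card (lucas_Theta (m + 3) (Suc 0))"
    by (rule card_Theta_ge[where f = "\<lambda>w. False # False # w @ [False]"])
       (auto simp: inj_on_def lucas_strings_successively successively_Cons successively_append_iff
         dest: fib_strings_no_consecutive)
  then show ?thesis by simp
qed

text \<open>Here the padded places are coordinate \<open>n\<close> and its cyclic neighbours,
  \<open>n - 1\<close> and 1.\<close>

lemma card_Theta_last: "fib (m + 2) \<le> card (lucas_Theta (m + 3) (m + 3))"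
proof -
  have upd: "(False # w @ [False, False])[m + 2 := True] = False # w @ [False, True]"
    if "length w = m" for w
    using that by (simp add: list_update_append)
  have "fib (m + 2) \<le> card (lucas_Theta (m + 3) (Suc (m + 2)))"
  proof (rule card_Theta_ge[where f = "\<lambda>w. False # w @ [False, False]"])
    fix w assume "w \<in> fib_strings m"
    then have w: "length w = m" "successively (\<lambda>a b. \<not> (a \<and> b)) w"
      using fib_strings_no_consecutive by auto
    show "(False # w @ [False, False])[m + 2 := True] \<in> lucas_strings (m + 3)"
      unfolding upd[OF w(1)] using w
      by (simp add: lucas_strings_successively successively_Cons successively_append_iff)
    show "False # w @ [False, False] \<in> lucas_strings (m + 3)"
      using w by (simp add: lucas_strings_successively successively_Cons successively_append_iff)
    show "\<not> (False # w @ [False, False]) ! (m + 2)"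
      using w by (simp add: nth_append)
  qed (auto simp: inj_on_def)
  then show ?thesis by (simp add: numeral_3_eq_3)
qed

section \<open>The lower bound for \<open>gp_e\<close>\<close>

text \<open>Finitely many edges leave finitely many candidate cardinalities, so the
  \<open>Max\<close> in \<open>gp_e\<close> is a true upper bound.\<close>

lemma card_le_gp_e:
  assumes "finite (edges G)" "edge_general_position G X"
  shows "card X \<le> gp_e G"
proof -
  have "{card X | X. edge_general_position G X} \<subseteq> card ` Pow (edges G)"
    by (auto simp: edge_general_position_def)
  then have "finite {card X | X. edge_general_position G X}"
    by (rule finite_subset) (simp add: assms(1))
  then show ?thesis
    unfolding gp_e_def using assms(2) by (intro Max_ge) auto
qed

theorem theorem4p6:
  fixes n :: nat
  assumes "n \<ge> 4"
  shows "maximal_edge_general_position (lucas_cube n) (lucas_Theta n 1 \<union> lucas_Theta n n) \<and>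
         gp_e (lucas_cube n) \<ge> 2 * fib (n - 1)"
proof
  show max: "maximal_edge_general_position (lucas_cube n) (lucas_Theta n 1 \<union> lucas_Theta n n)"
    using assms by (rule maximal_edge_general_position_Theta)
  have fin: "finite (lucas_Theta n i)" for i
    using Theta_subset_edges finite_edges_lucas_cube by (rule finite_subset)
  \<comment> \<open>With this \<open>m\<close>, the count \<open>fib (m + 2)\<close> is
    \<open>fib (n - 1)\<close>.\<close>
  obtain m where m: "n = m + 3" using assms that[of "n - 3"] by simp
  have "2 * fib (n - 1) \<le> card (lucas_Theta n 1) + card (lucas_Theta n n)"
    using card_Theta_first[of m] card_Theta_last[of m] m by simp
  also have "\<dots> = card (lucas_Theta n 1 \<union> lucas_Theta n n)"
    using Theta_disjoint[of 0 n "n - 1"] assms fin by (simp add: card_Un_disjoint)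
  also have "\<dots> \<le> gp_e (lucas_cube n)"
    using max finite_edges_lucas_cube
    by (intro card_le_gp_e) (auto simp: maximal_edge_general_position_def)
  finally show "gp_e (lucas_cube n) \<ge> 2 * fib (n - 1)" .
qed

end
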